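(* Let $c\in(0,1)$ be a universal constant for which the Sudakov minoration bound stated in the context holds. Let $T$ be a finite nonempty set, let $\sigma>0$, and let $(X_t)_{t\in T}$ be i.i.d. $\mathcal{N}(0,\sigma^2)$ random variables. Then $$g(\beta)\ge c\,\sigma\sqrt{\mathbf{E} D(\nu_\beta\|\nu_0)}\qquad\text{for all }\beta\ge 0.$$
   Context: For $\beta\ge 0$, the random Gibbs measure $\nu_\beta$ on $T$ is the probability measure with $\nu_\beta(t)=e^{\beta X_t}/Z(\beta)$, $t\in T$, where $Z(\beta)=\sum_{t\in T}e^{\beta X_t}$; in particular $\nu_0$ is the uniform distribution on $T$. The quenched Gibbs average is $g(\beta):=\mathbf{E}\big[\frac{1}{Z(\beta)}\sum_{t\in T}X_te^{\beta X_t}\big]$. $D(\mu\|\nu)=\sum_{t\in T}\mu(t)\log\frac{\mu(t)}{\nu(t)}$ is the Kullback–Leibler divergence (natural logarithm), and $\mathbf{E}$ is expectation with respect to $X$. Sudakov minoration (known result fixing the constant $c$): there is a universal constant $0<c<1$ such that for every finite index set $T$ with $|T|\ge2$ and every centered Gaussian process $(X_t)_{t\in T}$ with $(\mathbf{E}|X_s-X_t|^2)^{1/2}\ge a>0$ for all distinct $s,t\in T$, one has $\mathbf{E}[\max_{t\in T}X_t]\ge c\,a\sqrt{\log|T|}$. *)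

theory Defs
  imports "HOL-Probability.Probability"
begin

section \<open>Gaussian processes\<close>

text \<open>Degenerate (almost surely constant) variables count as Gaussian: a linear combination of the
  coordinates of a Gaussian process may have variance zero, whereas \<^const>\<open>normal_density\<close> only
  describes the nondegenerate case.\<close>

definition gaussian_rv :: "'w measure \<Rightarrow> ('w \<Rightarrow> real) \<Rightarrow> bool" where
  "gaussian_rv M Y \<longleftrightarrow>
     (\<exists>\<mu> \<sigma>. 0 < \<sigma> \<and> distributed M lborel Y (normal_density \<mu> \<sigma>)) \<or>
     (\<exists>\<mu>. Y \<in> borel_measurable M \<and> (AE \<omega> in M. Y \<omega> = \<mu>))"

definition centered_gaussian_process :: "'w measure \<Rightarrow> 'i set \<Rightarrow> ('i \<Rightarrow> 'w \<Rightarrow> real) \<Rightarrow> bool" where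
  "centered_gaussian_process M T X \<longleftrightarrow>
     (\<forall>J a. finite J \<and> J \<subseteq> T \<longrightarrow> gaussian_rv M (\<lambda>\<omega>. \<Sum>t\<in>J. a t * X t \<omega>)) \<and>
     (\<forall>t\<in>T. (LINT \<omega>|M. X t \<omega>) = 0)"

definition sudakov_bound :: "real \<Rightarrow> 'w measure \<Rightarrow> 'i set \<Rightarrow> ('i \<Rightarrow> 'w \<Rightarrow> real) \<Rightarrow> bool" where
  "sudakov_bound c M T X \<longleftrightarrow>
     (\<forall>a>0. (\<forall>s\<in>T. \<forall>t\<in>T. s \<noteq> t \<longrightarrow> a \<le> sqrt (LINT \<omega>|M. \<bar>X s \<omega> - X t \<omega>\<bar>\<^sup>2)) \<longrightarrow>
        c * a * sqrt (ln (real (card T))) \<le> (LINT \<omega>|M. Max ((\<lambda>t. X t \<omega>) ` T)))"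

text \<open>A definition cannot quantify over types, so the index sets range over finite sets of natural
  numbers and the sample spaces over measures on \<^typ>\<open>nat \<Rightarrow> real\<close>. This loses nothing, since the
  bound only depends on the joint law of the finitely many variables: the theorem
  \<open>sudakov_constantD\<close> below recovers it for arbitrary types.\<close>

definition sudakov_constant :: "real \<Rightarrow> bool" where
  "sudakov_constant c \<longleftrightarrow>
     (\<forall>(M :: (nat \<Rightarrow> real) measure) (T :: nat set) X.
        prob_space M \<longrightarrow> finite T \<longrightarrow> 2 \<le> card T \<longrightarrow> centered_gaussian_process M T X \<longrightarrow>
        sudakov_bound c M T X)"

lemma gaussian_rv_measurable: "gaussian_rv M Y \<Longrightarrow> Y \<in> borel_measurable M"
  by (auto simp: gaussian_rv_def distributed_def)

lemma centered_gaussian_process_measurable: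
  assumes "centered_gaussian_process M T X" "t \<in> T"
  shows "X t \<in> borel_measurable M"
proof -
  have lin: "\<And>J a. finite J \<Longrightarrow> J \<subseteq> T \<Longrightarrow> gaussian_rv M (\<lambda>\<omega>. \<Sum>t\<in>J. a t * X t \<omega>)"
    using assms(1) by (simp add: centered_gaussian_process_def)
  have "gaussian_rv M (\<lambda>\<omega>. \<Sum>s\<in>{t}. 1 * X s \<omega>)"
    using assms(2) by (intro lin) auto
  then show ?thesis
    by (auto dest: gaussian_rv_measurable)
qed

lemma gaussian_rv_distr:
  assumes [measurable]: "F \<in> measurable M N" "Y \<in> borel_measurable N"
    and "gaussian_rv M (\<lambda>\<omega>. Y (F \<omega>))"
  shows "gaussian_rv (distr M N F) Y"
  using assms(3)
  by (auto simp: gaussian_rv_def distributed_def distr_distr comp_def AE_distr_iff)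

theorem sudakov_constantD:
  fixes M :: "'w measure" and T :: "'i set" and X :: "'i \<Rightarrow> 'w \<Rightarrow> real"
  assumes c: "sudakov_constant c" and M: "prob_space M" and T: "finite T" "2 \<le> card T"
    and X: "centered_gaussian_process M T X"
  shows "sudakov_bound c M T X"
proof -
  define I where "I = {..<card T}"
  obtain f where f: "bij_betw f I T"
    using ex_bij_betw_nat_finite[OF T(1)] by (auto simp: I_def atLeast0LessThan)
  have fT: "f i \<in> T" if "i \<in> I" for i
    using f that by (auto simp: bij_betw_def)
  have I: "finite I" "card I = card T"
    by (auto simp: I_def)
  define P where "P = PiM I (\<lambda>_. borel :: real measure)"
  define F where "F = (\<lambda>\<omega>. \<lambda>i\<in>I. X (f i) \<omega>)"
  define N where "N = distr M P F"
  define Y where "Y = (\<lambda>i (\<omega> :: nat \<Rightarrow> real). \<omega> i)"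
  have F[measurable]: "F \<in> measurable M P"
    unfolding F_def P_def
    by (intro measurable_restrict centered_gaussian_process_measurable[OF X] fT)
  have Y[measurable]: "Y i \<in> borel_measurable P" if "i \<in> I" for i
    unfolding Y_def P_def using that by measurable
  have YF: "Y i (F \<omega>) = X (f i) \<omega>" if "i \<in> I" for i \<omega>
    using that by (simp add: Y_def F_def)
  have N: "prob_space N"
    unfolding N_def by (intro prob_space.prob_space_distr M F)
  have gauss: "gaussian_rv N (\<lambda>\<omega>. \<Sum>i\<in>J. a i * Y i \<omega>)" if J: "finite J" "J \<subseteq> I" for J a
    unfolding N_def
  proof (rule gaussian_rv_distr[OF F])
    show "(\<lambda>\<omega>. \<Sum>i\<in>J. a i * Y i \<omega>) \<in> borel_measurable P"
      using J by (intro borel_measurable_sum borel_measurable_times) (auto intro: Y)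
    have inj: "inj_on f J"
      using f J(2) by (auto simp: bij_betw_def intro: inj_on_subset)
    have "(\<Sum>i\<in>J. a i * Y i (F \<omega>)) = (\<Sum>t\<in>f ` J. a (the_inv_into J f t) * X t \<omega>)" for \<omega>
      using J(2) by (auto simp: sum.reindex[OF inj] the_inv_into_f_f[OF inj] YF intro!: sum.cong)
    moreover have "gaussian_rv M (\<lambda>\<omega>. \<Sum>t\<in>f ` J. a (the_inv_into J f t) * X t \<omega>)"
    proof -
      have "finite (f ` J) \<and> f ` J \<subseteq> T"
        using J fT by auto
      then show ?thesis
        using X by (simp add: centered_gaussian_process_def)
    qed
    ultimately show "gaussian_rv M (\<lambda>\<omega>. \<Sum>i\<in>J. a i * Y i (F \<omega>))"
      by simp
  qed
  have "(LINT \<omega>|N. Y i \<omega>) = 0" if "i \<in> I" for i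
    using X fT[OF that] that
    by (simp add: N_def integral_distr[OF F] Y YF centered_gaussian_process_def)
  with gauss have "centered_gaussian_process N I Y"
    by (auto simp: centered_gaussian_process_def)
  with c N I T(2) have *: "sudakov_bound c N I Y"
    unfolding sudakov_constant_def by auto
  have dist: "(LINT \<omega>|N. \<bar>Y i \<omega> - Y j \<omega>\<bar>\<^sup>2) = (LINT \<omega>|M. \<bar>X (f i) \<omega> - X (f j) \<omega>\<bar>\<^sup>2)"
    if "i \<in> I" "j \<in> I" for i j
    unfolding N_def using that Y[OF that(1)] Y[OF that(2)]
    by (subst integral_distr[OF F]) (auto simp: YF)
  have max: "(LINT \<omega>|N. Max ((\<lambda>i. Y i \<omega>) ` I)) = (LINT \<omega>|M. Max ((\<lambda>t. X t \<omega>) ` T))"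
  proof -
    have "(\<lambda>i. Y i (F \<omega>)) ` I = (\<lambda>t. X t \<omega>) ` T" for \<omega>
    proof -
      have "(\<lambda>i. Y i (F \<omega>)) ` I = (\<lambda>i. X (f i) \<omega>) ` I"
        using YF by (intro image_cong) auto
      also have "\<dots> = (\<lambda>t. X t \<omega>) ` T"
        using f by (auto simp: bij_betw_def)
      finally show ?thesis .
    qed
    moreover have "(\<lambda>\<omega>. Max ((\<lambda>i. Y i \<omega>) ` I)) \<in> borel_measurable P"
      using I(1) Y by (intro borel_measurable_Max) auto
    ultimately show ?thesis
      unfolding N_def by (simp add: integral_distr[OF F])
  qed
  show ?thesis
    unfolding sudakov_bound_def
  proof (intro allI impI)
    fix a :: real
    assume a: "0 < a" and
      sep: "\<forall>s\<in>T. \<forall>t\<in>T. s \<noteq> t \<longrightarrow> a \<le> sqrt (LINT \<omega>|M. \<bar>X s \<omega> - X t \<omega>\<bar>\<^sup>2)"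
    have "\<forall>i\<in>I. \<forall>j\<in>I. i \<noteq> j \<longrightarrow> a \<le> sqrt (LINT \<omega>|N. \<bar>Y i \<omega> - Y j \<omega>\<bar>\<^sup>2)"
    proof (intro ballI impI)
      fix i j
      assume ij: "i \<in> I" "j \<in> I" "i \<noteq> j"
      then have "f i \<noteq> f j"
        using f by (auto simp: bij_betw_def inj_on_def)
      then show "a \<le> sqrt (LINT \<omega>|N. \<bar>Y i \<omega> - Y j \<omega>\<bar>\<^sup>2)"
        using sep fT ij by (simp only: dist) blast
    qed
    with * a have "c * a * sqrt (ln (real (card I))) \<le> (LINT \<omega>|N. Max ((\<lambda>i. Y i \<omega>) ` I))"
      unfolding sudakov_bound_def by blast
    then show "c * a * sqrt (ln (real (card T))) \<le> (LINT \<omega>|M. Max ((\<lambda>t. X t \<omega>) ` T))"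
      by (simp only: I(2) max)
  qed
qed


section \<open>Gibbs measures\<close>

text \<open>Probability measures on the finite set \<open>T\<close> are represented by their mass functions, and \<open>x\<close> is
  a realisation \<open>\<lambda>t. X t \<omega>\<close> of the process.\<close>

definition partition_function :: "'i set \<Rightarrow> ('i \<Rightarrow> real) \<Rightarrow> real \<Rightarrow> real" where
  "partition_function T x \<beta> = (\<Sum>t\<in>T. exp (\<beta> * x t))"

definition gibbs :: "'i set \<Rightarrow> ('i \<Rightarrow> real) \<Rightarrow> real \<Rightarrow> 'i \<Rightarrow> real" where
  "gibbs T x \<beta> t = exp (\<beta> * x t) / partition_function T x \<beta>"

text \<open>Only meant for \<open>\<nu>\<close> that is positive on \<open>T\<close>, as every Gibbs measure is.\<close>

definition KL_div :: "'i set \<Rightarrow> ('i \<Rightarrow> real) \<Rightarrow> ('i \<Rightarrow> real) \<Rightarrow> real" where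
  "KL_div T \<mu> \<nu> = (\<Sum>t\<in>T. \<mu> t * ln (\<mu> t / \<nu> t))"

definition quenched_gibbs_average ::
    "'w measure \<Rightarrow> 'i set \<Rightarrow> ('i \<Rightarrow> 'w \<Rightarrow> real) \<Rightarrow> real \<Rightarrow> real" where
  "quenched_gibbs_average M T X \<beta> =
     (LINT \<omega>|M. 1 / partition_function T (\<lambda>t. X t \<omega>) \<beta> * (\<Sum>t\<in>T. X t \<omega> * exp (\<beta> * X t \<omega>)))"

end

theory Submission
  imports Defs "HOL-Real_Asymp.Real_Asymp"
begin

text \<open>Put \<open>F(\<beta>) = E log Z(\<beta>)\<close>, so that \<open>F' = g\<close> and \<open>E D(\<nu>\<^sub>\<beta> \<parallel> \<nu>\<^sub>0) = \<beta> g(\<beta>) - F(\<beta>) + log |T|\<close>.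
  Gaussian integration by parts gives \<open>g(\<beta>) = \<sigma>\<^sup>2 \<beta> (1 - E \<Sum>\<^sub>t \<nu>\<^sub>\<beta>(t)\<^sup>2)\<close>. Since
  \<open>\<Sum>\<^sub>t \<nu>\<^sub>\<beta>(t)\<^sup>2 = Z(2\<beta>) / Z(\<beta>)\<^sup>2\<close> increases with \<open>\<beta>\<close>, the ratio \<open>g(\<beta>) / \<beta>\<close> decreases, hence
  \<open>F(s) - s\<^sup>2 g(\<beta>) / (2\<beta>)\<close> is maximal over \<open>s \<ge> 0\<close> at \<open>s = \<beta>\<close>. Let \<open>K = c\<^sup>2 \<sigma>\<^sup>2\<close>.
  If \<open>2 g(\<beta>) \<ge> K \<beta>\<close>, comparison with \<open>s = 0\<close> gives \<open>E D \<le> \<beta> g(\<beta>) / 2 \<le> g(\<beta>)\<^sup>2 / K\<close>.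
  Otherwise use \<open>F(s) \<ge> s e\<close> with \<open>e = E max\<^sub>t X\<^sub>t\<close>, the choice \<open>s = \<beta> e / g(\<beta>)\<close>, and
  \<open>e\<^sup>2 \<ge> 2 K log |T|\<close>, which is Sudakov minoration at the separation \<open>a = \<sigma> \<surd>2\<close>.\<close>

section \<open>Gibbs measures of a fixed realisation\<close>

definition gibbs_mean :: "'i set \<Rightarrow> ('i \<Rightarrow> real) \<Rightarrow> real \<Rightarrow> real" where
  "gibbs_mean T x \<beta> = (\<Sum>t\<in>T. gibbs T x \<beta> t * x t)"

lemma partition_function_pos:
  assumes "finite T" "T \<noteq> {}"
  shows "0 < partition_function T x \<beta>"
  using assms unfolding partition_function_def by (intro sum_pos) auto

lemma gibbs_nonneg: "0 \<le> gibbs T x \<beta> t"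
  by (simp add: gibbs_def partition_function_def sum_nonneg)

lemma sum_gibbs:
  assumes "finite T" "T \<noteq> {}"
  shows "(\<Sum>t\<in>T. gibbs T x \<beta> t) = 1"
  using partition_function_pos[OF assms, of x \<beta>]
  by (simp add: gibbs_def flip: sum_divide_distrib) (simp add: partition_function_def)

lemma gibbs_le_1:
  assumes "finite T" "t \<in> T"
  shows "gibbs T x \<beta> t \<le> 1"
proof -
  have "gibbs T x \<beta> t \<le> (\<Sum>t\<in>T. gibbs T x \<beta> t)"
    using assms by (intro member_le_sum gibbs_nonneg) auto
  also have "\<dots> = 1" using assms by (intro sum_gibbs) auto
  finally show ?thesis .
qed

lemma gibbs_mean_bounds:
  assumes "finite T" "T \<noteq> {}"
  shows gibbs_mean_le_Max: "gibbs_mean T x \<beta> \<le> Max (x ` T)"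
    and abs_gibbs_mean_le: "\<bar>gibbs_mean T x \<beta>\<bar> \<le> (\<Sum>t\<in>T. \<bar>x t\<bar>)"
proof -
  have "gibbs_mean T x \<beta> \<le> (\<Sum>t\<in>T. gibbs T x \<beta> t * Max (x ` T))"
    unfolding gibbs_mean_def using assms
    by (intro sum_mono mult_left_mono gibbs_nonneg) auto
  then show "gibbs_mean T x \<beta> \<le> Max (x ` T)"
    using sum_gibbs[OF assms, of x \<beta>] by (simp flip: sum_distrib_right)
  show "\<bar>gibbs_mean T x \<beta>\<bar> \<le> (\<Sum>t\<in>T. \<bar>x t\<bar>)"
    unfolding gibbs_mean_def
  proof (rule sum_abs[THEN order_trans], rule sum_mono)
    fix t assume "t \<in> T"
    then show "\<bar>gibbs T x \<beta> t * x t\<bar> \<le> \<bar>x t\<bar>"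
      using assms gibbs_nonneg[of T x \<beta> t] gibbs_le_1[of T t x \<beta>]
      by (simp add: abs_mult mult_left_le_one_le)
  qed
qed

lemma gibbs_0: "gibbs T x 0 t = 1 / real (card T)"
  by (simp add: gibbs_def partition_function_def)

lemma KL_div_gibbs:
  assumes "finite T" "T \<noteq> {}"
  shows "KL_div T (gibbs T x \<beta>) (gibbs T x 0) =
    \<beta> * gibbs_mean T x \<beta> - ln (partition_function T x \<beta>) + ln (real (card T))"
proof -
  note Z = partition_function_pos[OF assms, of x \<beta>]
  have n: "0 < real (card T)" using assms by (simp add: card_gt_0_iff)
  have "ln (gibbs T x \<beta> t / gibbs T x 0 t) =
      \<beta> * x t + (ln (real (card T)) - ln (partition_function T x \<beta>))" for t
    using Z n by (simp add: gibbs_0) (simp add: gibbs_def ln_mult ln_div)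
  then have "KL_div T (gibbs T x \<beta>) (gibbs T x 0) = \<beta> * gibbs_mean T x \<beta>
      + (\<Sum>t\<in>T. gibbs T x \<beta> t) * (ln (real (card T)) - ln (partition_function T x \<beta>))"
    by (simp add: KL_div_def gibbs_mean_def distrib_left sum.distrib sum_distrib_left
        sum_distrib_right mult_ac)
  then show ?thesis by (simp add: sum_gibbs[OF assms])
qed

section \<open>Convexity of the log-partition function\<close>

text \<open>Jensen's inequality: \<open>Z(r) / Z(s)\<close> is the average of
  \<open>exp ((r - s) * x t)\<close> under the Gibbs measure at \<open>s\<close>. Stated as an
  inequality between fixed parameters, it survives expectations without differentiating under the
  integral.\<close>

lemma ln_partition_function_subgradient:
  assumes "finite T" "T \<noteq> {}"
  shows "(r - s) * gibbs_mean T x s \<le>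
    ln (partition_function T x r) - ln (partition_function T x s)"
proof -
  note Z = partition_function_pos[OF assms, of x]
  let ?m = "(r - s) * gibbs_mean T x s"
  \<comment> \<open>Deviations from the Gibbs mean average to zero, so the tangent line
    \<open>1 + y \<le> exp y\<close> taken at the mean loses nothing on the left.\<close>
  have "1 = (\<Sum>t\<in>T. gibbs T x s t * (1 + ((r - s) * x t - ?m)))"
    using sum_gibbs[OF assms, of x s]
    by (simp add: distrib_left right_diff_distrib sum.distrib sum_subtractf
        flip: sum_distrib_right)
       (simp add: gibbs_mean_def sum_distrib_left mult_ac)
  also have "\<dots> \<le> (\<Sum>t\<in>T. gibbs T x s t * exp ((r - s) * x t - ?m))"
    by (intro sum_mono mult_left_mono gibbs_nonneg) auto
  also have "\<dots> = exp (- ?m) * (partition_function T x r / partition_function T x s)"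
  proof -
    have "exp (s * x t) * exp ((r - s) * x t - ?m) = exp (- ?m) * exp (r * x t)" for t
      by (simp add: algebra_simps flip: exp_add)
    then have "gibbs T x s t * exp ((r - s) * x t - ?m) =
        exp (- ?m) * (exp (r * x t) / partition_function T x s)" for t
      by (simp add: gibbs_def)
    then show ?thesis
      by (simp add: partition_function_def[of T x r] sum_distrib_left sum_divide_distrib)
  qed
  finally have "exp ?m * 1 \<le>
      exp ?m * (exp (- ?m) * (partition_function T x r / partition_function T x s))"
    by (intro mult_left_mono) auto
  then have "exp ?m \<le> partition_function T x r / partition_function T x s"
    by (simp only: mult.assoc[symmetric] exp_add[symmetric]) simp
  then have "?m \<le> ln (partition_function T x r / partition_function T x s)"
    using Z by (subst ln_ge_iff) auto
  then show ?thesis using Z[of r] Z[of s] by (simp add: ln_div)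
qed

text \<open>Add the subgradient inequalities from \<open>s\<close> to \<open>r\<close> and from
  \<open>r\<close> to \<open>s\<close>: the values of \<open>ln Z\<close> cancel.\<close>

lemma gibbs_mean_mono:
  assumes "finite T" "T \<noteq> {}" "s \<le> r"
  shows "gibbs_mean T x s \<le> gibbs_mean T x r"
proof (cases "s = r")
  case False
  have "(r - s) * gibbs_mean T x s \<le> (r - s) * gibbs_mean T x r"
    using ln_partition_function_subgradient[OF assms(1,2), of r s x]
      ln_partition_function_subgradient[OF assms(1,2), of s r x]
    by (simp add: algebra_simps)
  then show ?thesis using False assms(3) by simp
qed simp

lemma ln_partition_function_has_derivative:
  assumes "finite T" "T \<noteq> {}"
  shows "((\<lambda>\<beta>. ln (partition_function T x \<beta>)) has_real_derivative gibbs_mean T x \<beta>) (at \<beta>)"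
proof -
  have "((\<lambda>\<beta>. partition_function T x \<beta>) has_real_derivative
      (\<Sum>t\<in>T. exp (\<beta> * x t) * x t)) (at \<beta>)"
    unfolding partition_function_def
    by (rule DERIV_sum) (auto intro!: derivative_eq_intros)
  from DERIV_chain2[where f = ln, OF DERIV_ln_divide[OF partition_function_pos[OF assms]] this]
  show ?thesis by (simp add: gibbs_mean_def gibbs_def sum_divide_distrib sum_distrib_left)
qed

section \<open>Monotonicity of the sum of squared Gibbs weights\<close>

text \<open>The sum is \<open>Z(2\<beta>) / Z(\<beta>)^2\<close>; the exponential form reduces its
  monotonicity to the sign of the derivative of the exponent.\<close>

lemma sum_gibbs_power2:
  assumes "finite T" "T \<noteq> {}"
  shows "(\<Sum>t\<in>T. (gibbs T x \<beta> t)\<^sup>2) =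
    exp (ln (partition_function T x (2 * \<beta>)) - 2 * ln (partition_function T x \<beta>))"
proof -
  note Z = partition_function_pos[OF assms, of x]
  have "exp (2 * ln (partition_function T x \<beta>)) = (partition_function T x \<beta>)\<^sup>2"
    using Z[of \<beta>] by (simp add: exp_double)
  moreover have "(exp (\<beta> * x t))\<^sup>2 = exp (2 * \<beta> * x t)" for t
    by (simp add: mult.assoc exp_double)
  ultimately show ?thesis
    using Z by (simp add: exp_diff gibbs_def power_divide)
      (simp add: partition_function_def sum_divide_distrib)
qed

text \<open>The exponent has derivative \<open>2 * (m (2 * \<beta>) - m \<beta>)\<close>, where
  \<open>m\<close> is the Gibbs mean, which is increasing; for \<open>\<beta> \<ge> 0\<close> one
  has \<open>\<beta> \<le> 2 * \<beta>\<close>.\<close>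

lemma sum_gibbs_power2_mono:
  assumes "finite T" "T \<noteq> {}" "0 \<le> s" "s \<le> r"
  shows "(\<Sum>t\<in>T. (gibbs T x s t)\<^sup>2) \<le> (\<Sum>t\<in>T. (gibbs T x r t)\<^sup>2)"
proof -
  let ?f = "\<lambda>\<beta>. ln (partition_function T x (2 * \<beta>)) - 2 * ln (partition_function T x \<beta>)"
  have "?f s \<le> ?f r"
  proof (rule DERIV_nonneg_imp_nondecreasing[OF assms(4)])
    fix \<beta> assume "s \<le> \<beta>" "\<beta> \<le> r"
    have "((\<lambda>\<beta>. ln (partition_function T x (2 * \<beta>))) has_real_derivative
        gibbs_mean T x (2 * \<beta>) * 2) (at \<beta>)"
      by (rule DERIV_chain2[OF ln_partition_function_has_derivative[OF assms(1,2)]])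
        (auto intro!: derivative_eq_intros)
    then have "(?f has_real_derivative gibbs_mean T x (2 * \<beta>) * 2 - 2 * gibbs_mean T x \<beta>) (at \<beta>)"
      by (intro DERIV_diff DERIV_cmult ln_partition_function_has_derivative assms)
    moreover have "gibbs_mean T x \<beta> \<le> gibbs_mean T x (2 * \<beta>)"
      using \<open>s \<le> \<beta>\<close> assms by (intro gibbs_mean_mono) auto
    ultimately show "\<exists>y. (?f has_real_derivative y) (at \<beta>) \<and> 0 \<le> y" by force
  qed
  then show ?thesis by (simp add: sum_gibbs_power2[OF assms(1,2)])
qed

section \<open>Integrating a subgradient\<close>

text \<open>Telescoping over \<open>N\<close> equal pieces gives a total increment of at most
  \<open>C * (b - a)^2 / N\<close>, which tends to zero. This replaces a derivative test when only
  subgradient inequalities are at hand.\<close>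

lemma nonincreasing_if_quadratic_increments:
  fixes \<phi> :: "real \<Rightarrow> real"
  assumes incr: "\<And>s r. a \<le> s \<Longrightarrow> s \<le> r \<Longrightarrow> r \<le> b \<Longrightarrow> \<phi> r - \<phi> s \<le> C * (r - s)\<^sup>2" and "a \<le> b"
  shows "\<phi> b \<le> \<phi> a"
proof -
  have "\<phi> b - \<phi> a \<le> C * (b - a)\<^sup>2 / real N" if "0 < N" for N
  proof -
    define p where "p i = a + real i / real N * (b - a)" for i
    have p: "p 0 = a" "p N = b" using that by (simp_all add: p_def)
    have "\<phi> b - \<phi> a = (\<Sum>i<N. \<phi> (p (Suc i)) - \<phi> (p i))"
      by (simp add: sum_lessThan_telescope[of "\<lambda>i. \<phi> (p i)"] p)
    also have "\<dots> \<le> (\<Sum>i<N. C * ((b - a) / real N)\<^sup>2)"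
    proof (rule sum_mono)
      fix i assume i: "i \<in> {..<N}"
      have d: "p (Suc i) - p i = (b - a) / real N"
        by (simp add: p_def add_divide_distrib algebra_simps)
      have "real (Suc i) / real N * (b - a) \<le> 1 * (b - a)"
        using i \<open>a \<le> b\<close> by (intro mult_right_mono) auto
      then have "p (Suc i) \<le> b" by (simp add: p_def)
      moreover have "a \<le> p i" using \<open>a \<le> b\<close> by (simp add: p_def)
      moreover have "p i \<le> p (Suc i)"
        using d \<open>a \<le> b\<close> by (smt (verit) divide_nonneg_nonneg of_nat_0_le_iff)
      ultimately show "\<phi> (p (Suc i)) - \<phi> (p i) \<le> C * ((b - a) / real N)\<^sup>2"
        using incr[of "p i" "p (Suc i)"] by (simp add: d)
    qed
    also have "\<dots> = C * (b - a)\<^sup>2 / real N"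
      using that by (simp add: power2_eq_square)
    finally show ?thesis .
  qed
  then have "eventually (\<lambda>N. \<phi> b - \<phi> a \<le> C * (b - a)\<^sup>2 / real N) sequentially"
    by (auto intro: eventually_mono[OF eventually_gt_at_top[of 0]])
  moreover have "(\<lambda>N. C * (b - a)\<^sup>2 / real N) \<longlonglongrightarrow> 0" by real_asymp
  ultimately have "\<phi> b - \<phi> a \<le> 0"
    by (intro tendsto_lowerbound[of _ 0 sequentially]) auto
  then show ?thesis by simp
qed

text \<open>Integrates \<open>F' = g\<close>: the function \<open>F s - s\<^sup>2 * (g \<beta> / \<beta>) / 2\<close>, with derivative
  \<open>g s - s * (g \<beta> / \<beta>)\<close>, is maximal at \<open>\<beta>\<close>.\<close>

lemma subgradient_parabola_bound:
  fixes F g :: "real \<Rightarrow> real"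
  assumes sub: "\<And>s r. 0 \<le> s \<Longrightarrow> 0 \<le> r \<Longrightarrow> (r - s) * g s \<le> F r - F s"
    and anti: "\<And>s r. 0 < s \<Longrightarrow> s \<le> r \<Longrightarrow> g r / r \<le> g s / s"
    and g0: "g 0 = 0" and \<beta>: "0 < \<beta>" and s: "0 \<le> s"
  shows "F s - s\<^sup>2 * (g \<beta> / \<beta>) / 2 \<le> F \<beta> - \<beta> * g \<beta> / 2"
proof -
  define k where "k = g \<beta> / \<beta>"
  define \<phi> where "\<phi> s = F s - s\<^sup>2 * k / 2" for s
  have "\<phi> s \<le> \<phi> \<beta>"
  proof (cases "s \<le> \<beta>")
    case True
    \<comment> \<open>Left of \<open>\<beta>\<close> the function \<open>\<phi>\<close> has to
      increase, so the increment criterion is applied to \<open>- \<phi>\<close>, with the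
      subgradient at the left end \<open>u\<close> of each piece.\<close>
    have "- \<phi> \<beta> \<le> - \<phi> s"
    proof (rule nonincreasing_if_quadratic_increments[OF _ True, where C = "k / 2"])
      fix u r assume ur: "s \<le> u" "u \<le> r" "r \<le> \<beta>"
      \<comment> \<open>The ratio hypothesis covers only positive arguments; at \<open>u = 0\<close>
        both sides vanish by \<open>g0\<close>.\<close>
      have "u * k \<le> g u"
        using anti[of u \<beta>] ur s \<beta> g0 by (cases "u = 0") (auto simp: k_def field_simps)
      then have "(r - u) * (u * k) \<le> (r - u) * g u"
        using ur by (intro mult_left_mono) auto
      then show "- \<phi> r - - \<phi> u \<le> k / 2 * (r - u)\<^sup>2"
        using sub[of u r] ur s unfolding \<phi>_def by (simp add: power2_eq_square field_simps)
    qed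
    then show ?thesis by simp
  next
    case False
    show ?thesis
    \<comment> \<open>Right of \<open>\<beta>\<close> the subgradient at the right end
      \<open>r\<close> bounds the increment of \<open>F\<close> from above; replacing the slope of
      the parabola by its value at \<open>r\<close> costs exactly
      \<open>k / 2 * (r - u)^2\<close>.\<close>
    proof (rule nonincreasing_if_quadratic_increments[of \<beta> s \<phi> "k / 2"])
      fix u r assume ur: "\<beta> \<le> u" "u \<le> r" "r \<le> s"
      have "g r \<le> r * k"
        using anti[of \<beta> r] ur s \<beta> by (auto simp: k_def field_simps)
      then have "(r - u) * g r \<le> (r - u) * (r * k)"
        using ur by (intro mult_left_mono) auto
      then show "\<phi> r - \<phi> u \<le> k / 2 * (r - u)\<^sup>2"
        using sub[of r u] ur \<beta> unfolding \<phi>_def by (simp add: power2_eq_square field_simps)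
    qed (use False in simp)
  qed
  then show ?thesis using \<beta> by (simp add: \<phi>_def k_def power2_eq_square)
qed

section \<open>Gaussian integration by parts\<close>

text \<open>Stein's identity. The density \<open>n\<close> satisfies
  \<open>n' = - (x / \<sigma>^2) * n\<close>, so \<open>\<sigma>^2 * n * h' - n * x * h\<close> is
  the derivative of \<open>\<sigma>^2 * h * n\<close>. This primitive vanishes at both infinities
  because \<open>h\<close> is bounded, hence the integral is zero.\<close>

lemma gaussian_integration_by_parts:
  fixes h h' :: "real \<Rightarrow> real"
  assumes \<sigma>: "0 < \<sigma>"
    and deriv: "\<And>x. (h has_real_derivative h' x) (at x)"
    and cont: "\<And>x. isCont h' x"
    and bounded: "\<And>x. \<bar>h x\<bar> \<le> B" "\<And>x. \<bar>h' x\<bar> \<le> B'"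
  shows "(LINT x|density lborel (normal_density 0 \<sigma>). x * h x) =
    \<sigma>\<^sup>2 * (LINT x|density lborel (normal_density 0 \<sigma>). h' x)"
proof -
  let ?n = "normal_density 0 \<sigma>"
  have h[measurable]: "h \<in> borel_measurable borel"
    using deriv by (intro borel_measurable_continuous_onI continuous_at_imp_continuous_on)
      (auto intro: DERIV_isCont)
  have h'[measurable]: "h' \<in> borel_measurable borel"
    using cont by (intro borel_measurable_continuous_onI continuous_at_imp_continuous_on) auto
  have B: "0 \<le> B" "0 \<le> B'"
    using bounded[of 0] by auto
  have int1: "integrable lborel (\<lambda>x. ?n x * (x * h x))"
  proof (rule Bochner_Integration.integrable_bound)
    show "integrable lborel (\<lambda>x. B * (?n x * \<bar>x\<bar>))"
      using integrable_normal_moment_abs[OF \<sigma>, of 0 1] by simp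
    show "AE x in lborel. norm (?n x * (x * h x)) \<le> norm (B * (?n x * \<bar>x\<bar>))"
    proof (rule AE_I2)
      fix x :: real
      have "\<bar>h x\<bar> * (?n x * \<bar>x\<bar>) \<le> B * (?n x * \<bar>x\<bar>)"
        by (intro mult_right_mono bounded) simp
      then show "norm (?n x * (x * h x)) \<le> norm (B * (?n x * \<bar>x\<bar>))"
        using B by (simp add: abs_mult mult_ac)
    qed
  qed measurable
  have int2: "integrable lborel (\<lambda>x. ?n x * h' x)"
  proof (rule Bochner_Integration.integrable_bound)
    show "integrable lborel (\<lambda>x. B' * ?n x)" using \<sigma> by simp
    show "AE x in lborel. norm (?n x * h' x) \<le> norm (B' * ?n x)"
    proof (rule AE_I2)
      fix x :: real
      have "\<bar>h' x\<bar> * ?n x \<le> B' * ?n x"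
        by (intro mult_right_mono bounded) simp
      then show "norm (?n x * h' x) \<le> norm (B' * ?n x)"
        using B by (simp add: abs_mult mult_ac)
    qed
  qed measurable
  let ?F = "\<lambda>x. \<sigma>\<^sup>2 * (h x * ?n x)"
  let ?f = "\<lambda>x. \<sigma>\<^sup>2 * (?n x * h' x) - ?n x * (x * h x)"
  have dn: "(?n has_real_derivative - (x / \<sigma>\<^sup>2) * ?n x) (at x)" for x
    unfolding normal_density_def using \<sigma> by (auto intro!: derivative_eq_intros simp: field_simps)
  have dF: "(?F has_real_derivative ?f x) (at x)" for x
    using \<sigma> by (auto intro!: derivative_eq_intros dn deriv simp: field_simps)
  have n_top: "(?n \<longlongrightarrow> 0) at_top" and n_bot: "(?n \<longlongrightarrow> 0) at_bot"
    unfolding normal_density_def using \<sigma> by real_asymp+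
  have F_lim: "(?F \<longlongrightarrow> 0) A" if "(?n \<longlongrightarrow> 0) A" for A
  proof (rule Lim_null_comparison)
    show "\<forall>\<^sub>F x in A. norm (?F x) \<le> \<sigma>\<^sup>2 * (B * ?n x)"
      by (intro always_eventually allI) (auto simp: abs_mult intro!: mult_left_mono mult_right_mono bounded)
    show "((\<lambda>x. \<sigma>\<^sup>2 * (B * ?n x)) \<longlongrightarrow> 0) A"
      using that by (intro tendsto_mult_right_zero)
  qed
  have intf: "integrable lborel ?f" using int1 int2 by simp
  have "(LBINT x=-\<infinity>..\<infinity>. ?f x) = 0 - 0"
  proof (rule interval_integral_FTC_integrable[where F = ?F])
    show "(?F has_vector_derivative ?f x) (at x)" for x
      using dF by (simp add: has_real_derivative_iff_has_vector_derivative)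
    show "isCont ?f x" for x
      using DERIV_isCont[OF dn] DERIV_isCont[OF deriv] cont by (intro continuous_intros) auto
    show "set_integrable lborel (einterval (- \<infinity>) \<infinity>) ?f"
      using intf by (simp add: set_integrable_def)
    show "((?F \<circ> real_of_ereal) \<longlongrightarrow> 0) (at_right (- \<infinity>))"
      "((?F \<circ> real_of_ereal) \<longlongrightarrow> 0) (at_left \<infinity>)"
      using F_lim n_top n_bot by (simp_all only: ereal_tendsto_simps)
  qed simp
  then have "(LINT x|lborel. ?f x) = 0"
    by (simp add: interval_lebesgue_integral_def set_lebesgue_integral_def)
  then have "\<sigma>\<^sup>2 * (LINT x|lborel. ?n x * h' x) = (LINT x|lborel. ?n x * (x * h x))"
    using int1 int2 by (simp add: Bochner_Integration.integral_diff)
  then show ?thesis by (simp add: integral_density)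
qed

lemma logistic_has_derivative:
  fixes R \<beta> :: real
  assumes "0 \<le> R"
  defines "h \<equiv> \<lambda>y. exp (\<beta> * y) / (exp (\<beta> * y) + R)"
  shows "(h has_real_derivative \<beta> * (h y * (1 - h y))) (at y)"
proof -
  have pos: "0 < exp (\<beta> * y) + R" for y
    using assms(1) by (simp add: add_pos_nonneg)
  have "(h has_real_derivative (exp (\<beta> * y) * \<beta> * (exp (\<beta> * y) + R) - exp (\<beta> * y) * (exp (\<beta> * y) * \<beta>)) /
      ((exp (\<beta> * y) + R) * (exp (\<beta> * y) + R))) (at y)"
    unfolding h_def using pos[of y] by (auto intro!: derivative_eq_intros)
  also have "(exp (\<beta> * y) * \<beta> * (exp (\<beta> * y) + R) - exp (\<beta> * y) * (exp (\<beta> * y) * \<beta>)) /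
      ((exp (\<beta> * y) + R) * (exp (\<beta> * y) + R)) = \<beta> * (h y * (1 - h y))"
    unfolding h_def using pos[of y] by (simp add: divide_simps) (simp add: algebra_simps)
  finally show ?thesis .
qed

section \<open>Quenched averages\<close>

lemma gibbs_cong: "(\<And>s. s \<in> T \<Longrightarrow> x s = y s) \<Longrightarrow> t \<in> T \<Longrightarrow> gibbs T x \<beta> t = gibbs T y \<beta> t"
  by (simp add: gibbs_def partition_function_def)

lemma gibbs_measurable [measurable]:
  assumes "t \<in> T"
  shows "(\<lambda>x. gibbs T x \<beta> t) \<in> borel_measurable (PiM T (\<lambda>_. borel))"
  unfolding gibbs_def partition_function_def using assms by measurable

section \<open>Integration by parts for i.i.d. Gaussian families\<close>

locale iid_centered_gaussians = prob_space M for M :: "'w measure" +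
  fixes T :: "'i set" and X :: "'i \<Rightarrow> 'w \<Rightarrow> real" and \<sigma> :: real
  assumes finite_T: "finite T" and T_nonempty: "T \<noteq> {}" and \<sigma>_pos: "0 < \<sigma>"
    and indep_X: "indep_vars (\<lambda>_. borel) X T"
    and normal_X: "\<And>t. t \<in> T \<Longrightarrow> distributed M lborel (X t) (normal_density 0 \<sigma>)"
begin

lemma X_measurable [measurable]: "t \<in> T \<Longrightarrow> X t \<in> borel_measurable M"
  using normal_X[of t] by (auto simp: distributed_def)

lemma integrable_X: "t \<in> T \<Longrightarrow> integrable M (X t)"
  using integrable_normal_moment_nz_1[OF \<sigma>_pos, of 0]
    distributed_integrable[OF normal_X[of t], of "\<lambda>x. x"] by simp

lemma expectation_X: "t \<in> T \<Longrightarrow> expectation (X t) = 0"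
  by (rule normal_distributed_expectation[OF \<sigma>_pos normal_X])

text \<open>Gibbs weights lie in \<open>[0, 1]\<close>, so they preserve integrability. The factor
  \<open>Y\<close> is general in order to cover constants, the variables themselves and further
  weights.\<close>

lemma integrable_gibbs_times:
  assumes "t \<in> T" and Y: "integrable M Y"
  shows "integrable M (\<lambda>\<omega>. Y \<omega> * gibbs T (\<lambda>s. X s \<omega>) \<beta> t)"
proof (rule Bochner_Integration.integrable_bound[OF Y])
  have [measurable]: "Y \<in> borel_measurable M" using Y by simp
  show "(\<lambda>\<omega>. Y \<omega> * gibbs T (\<lambda>s. X s \<omega>) \<beta> t) \<in> borel_measurable M"
    unfolding gibbs_def partition_function_def using assms(1) by measurable
  show "AE \<omega> in M. norm (Y \<omega> * gibbs T (\<lambda>s. X s \<omega>) \<beta> t) \<le> norm (Y \<omega>)"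
    using gibbs_nonneg[of T _ \<beta> t] gibbs_le_1[OF finite_T assms(1), of _ \<beta>]
    by (intro AE_I2) (simp add: abs_mult mult_left_le)
qed

text \<open>Independence recast as a product law, so that Fubini can integrate out a single
  coordinate.\<close>

lemma distr_X_eq_PiM:
  "distr M (PiM T (\<lambda>_. borel)) (\<lambda>\<omega>. \<lambda>t\<in>T. X t \<omega>) =
    PiM T (\<lambda>_. density lborel (normal_density 0 \<sigma>))"
proof -
  have "distr M borel (X t) = density lborel (normal_density 0 \<sigma>)" if "t \<in> T" for t
    using distributed_distr_eq_density[OF normal_X[OF that]] by (metis distr_cong sets_lborel)
  then have "PiM T (\<lambda>t. distr M borel (X t)) = PiM T (\<lambda>_. density lborel (normal_density 0 \<sigma>))"
    by (intro PiM_cong) auto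
  with indep_X show ?thesis
    using indep_vars_iff_distr_eq_PiM'[OF T_nonempty, of X "\<lambda>_. borel"] X_measurable by simp
qed

text \<open>With the other coordinates frozen, the weight of \<open>t\<close> is a logistic function
  of the coordinate \<open>t\<close>, with derivative \<open>\<beta>\<close> times weight times one
  minus weight. Stein's identity in that coordinate and Fubini in the rest give the claim.\<close>

lemma expectation_X_gibbs:
  assumes t: "t \<in> T"
  shows "expectation (\<lambda>\<omega>. X t \<omega> * gibbs T (\<lambda>s. X s \<omega>) \<beta> t) = \<sigma>\<^sup>2 * \<beta> *
    expectation (\<lambda>\<omega>. gibbs T (\<lambda>s. X s \<omega>) \<beta> t * (1 - gibbs T (\<lambda>s. X s \<omega>) \<beta> t))"
proof -
  define N where "N = density lborel (\<lambda>x. ennreal (normal_density 0 \<sigma> x))"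
  define I where "I = T - {t}"
  have I: "finite I" "t \<notin> I" "insert t I = T" using finite_T t by (auto simp: I_def)
  interpret N: prob_space N unfolding N_def by (rule prob_space_normal_density[OF \<sigma>_pos])
  interpret product_sigma_finite "\<lambda>_. N" ..
  have distr: "distr M (PiM T (\<lambda>_. borel)) (\<lambda>\<omega>. \<lambda>t\<in>T. X t \<omega>) = PiM T (\<lambda>_. N)"
    using distr_X_eq_PiM by (simp add: N_def)
  have X[measurable]: "(\<lambda>\<omega>. \<lambda>t\<in>T. X t \<omega>) \<in> measurable M (PiM T (\<lambda>_. borel))"
    by (intro measurable_restrict) simp
  have gibbs_X: "gibbs T (\<lambda>t\<in>T. X t \<omega>) \<beta> t = gibbs T (\<lambda>t. X t \<omega>) \<beta> t" for \<omega>
    using t by (intro gibbs_cong) auto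
  let ?f = "\<lambda>x. x t * gibbs T x \<beta> t"
  let ?f' = "\<lambda>x. gibbs T x \<beta> t * (1 - gibbs T x \<beta> t)"
  have meas[measurable]: "?f \<in> borel_measurable (PiM T (\<lambda>_. borel))"
    "?f' \<in> borel_measurable (PiM T (\<lambda>_. borel))"
    using t by measurable
  have f: "integrable (PiM T (\<lambda>_. N)) ?f"
    using integrable_gibbs_times[OF t integrable_X[OF t]] t
    by (simp add: integrable_distr_eq gibbs_X flip: distr)
  have "integrable M (\<lambda>\<omega>. (1 - gibbs T (\<lambda>s. X s \<omega>) \<beta> t) * gibbs T (\<lambda>s. X s \<omega>) \<beta> t)"
    using integrable_gibbs_times[OF t, of "\<lambda>_. 1"]
    by (intro integrable_gibbs_times[OF t] Bochner_Integration.integrable_diff) auto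
  then have f': "integrable (PiM T (\<lambda>_. N)) ?f'"
    by (simp add: integrable_distr_eq gibbs_X mult.commute flip: distr)
  \<comment> \<open>The one-dimensional identity, for every frozen configuration \<open>x\<close> of
    the other coordinates.\<close>
  have inner: "(LINT y|N. ?f (x(t := y))) = \<sigma>\<^sup>2 * \<beta> * (LINT y|N. ?f' (x(t := y)))" for x
  proof -
    define R where "R = (\<Sum>s\<in>I. exp (\<beta> * x s))"
    define h where "h = (\<lambda>y. exp (\<beta> * y) / (exp (\<beta> * y) + R))"
    have R: "0 \<le> R" by (simp add: R_def sum_nonneg)
    have "(\<Sum>s\<in>I. exp (\<beta> * (x(t := y)) s)) = R" for y
      unfolding R_def using I by (intro sum.cong) auto
    then have gibbs: "gibbs T (x(t := y)) \<beta> t = h y" for y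
      using I by (simp add: gibbs_def partition_function_def h_def flip: I(3))
    have h: "0 \<le> h y" "h y \<le> 1" for y
      using gibbs_nonneg gibbs_le_1[OF finite_T t] by (simp_all flip: gibbs)
    have deriv: "(h has_real_derivative \<beta> * (h y * (1 - h y))) (at y)" for y
      unfolding h_def by (rule logistic_has_derivative[OF R])
    have "(LINT y|N. y * h y) = \<sigma>\<^sup>2 * (LINT y|N. \<beta> * (h y * (1 - h y)))"
      unfolding N_def
    proof (rule gaussian_integration_by_parts[OF \<sigma>_pos deriv])
      show "isCont (\<lambda>y. \<beta> * (h y * (1 - h y))) y" for y
        using DERIV_isCont[OF deriv] by (intro continuous_intros) auto
      show "\<bar>h y\<bar> \<le> 1" for y using h[of y] by simp
      show "\<bar>\<beta> * (h y * (1 - h y))\<bar> \<le> \<bar>\<beta>\<bar>" for y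
      proof -
        have "h y * (1 - h y) \<le> 1" using h[of y] by (intro mult_le_one) auto
        then show ?thesis using h[of y] by (simp add: abs_mult mult_left_le)
      qed
    qed
    then show ?thesis by (simp add: gibbs)
  qed
  have "expectation (\<lambda>\<omega>. X t \<omega> * gibbs T (\<lambda>s. X s \<omega>) \<beta> t) = (LINT x|PiM T (\<lambda>_. N). ?f x)"
    using t by (simp add: integral_distr gibbs_X flip: distr)
  also have "\<dots> = (LINT x|PiM I (\<lambda>_. N). LINT y|N. ?f (x(t := y)))"
    using product_integral_insert[OF I(1,2), of ?f] f by (simp only: I(3))
  also have "\<dots> = \<sigma>\<^sup>2 * \<beta> * (LINT x|PiM I (\<lambda>_. N). LINT y|N. ?f' (x(t := y)))"
    by (simp only: inner integral_mult_right_zero)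
  also have "\<dots> = \<sigma>\<^sup>2 * \<beta> * (LINT x|PiM T (\<lambda>_. N). ?f' x)"
    using product_integral_insert[OF I(1,2), of ?f'] f' by (simp only: I(3))
  also have "(LINT x|PiM T (\<lambda>_. N). ?f' x) =
      expectation (\<lambda>\<omega>. gibbs T (\<lambda>s. X s \<omega>) \<beta> t * (1 - gibbs T (\<lambda>s. X s \<omega>) \<beta> t))"
    by (simp add: integral_distr gibbs_X flip: distr)
  finally show ?thesis .
qed

section \<open>Averaged log-partition function, Gibbs mean and maximum\<close>

text \<open>The function \<open>F\<close> of the outline; \<open>mean_gibbs\<close> and
  \<open>mean_max\<close> below are its \<open>g\<close> and \<open>e\<close>.\<close>

definition mean_log_partition :: "real \<Rightarrow> real" where
  "mean_log_partition \<beta> = expectation (\<lambda>\<omega>. ln (partition_function T (\<lambda>t. X t \<omega>) \<beta>))"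

definition mean_gibbs :: "real \<Rightarrow> real" where
  "mean_gibbs \<beta> = expectation (\<lambda>\<omega>. gibbs_mean T (\<lambda>t. X t \<omega>) \<beta>)"

definition mean_max :: real where
  "mean_max = expectation (\<lambda>\<omega>. Max ((\<lambda>t. X t \<omega>) ` T))"

lemma quenched_gibbs_average_eq: "quenched_gibbs_average M T X \<beta> = mean_gibbs \<beta>"
  unfolding quenched_gibbs_average_def mean_gibbs_def gibbs_mean_def gibbs_def
  by (simp add: sum_distrib_left mult.commute)

lemma integrable_gibbs_mean: "integrable M (\<lambda>\<omega>. gibbs_mean T (\<lambda>t. X t \<omega>) \<beta>)"
  unfolding gibbs_mean_def using integrable_gibbs_times integrable_X
  by (intro Bochner_Integration.integrable_sum) (simp add: mult.commute)

lemma integrable_Max: "integrable M (\<lambda>\<omega>. Max ((\<lambda>t. X t \<omega>) ` T))"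
proof (rule Bochner_Integration.integrable_bound)
  show "integrable M (\<lambda>\<omega>. \<Sum>t\<in>T. \<bar>X t \<omega>\<bar>)"
    using integrable_X by (intro Bochner_Integration.integrable_sum integrable_abs)
  show "(\<lambda>\<omega>. Max ((\<lambda>t. X t \<omega>) ` T)) \<in> borel_measurable M"
    using finite_T by (intro borel_measurable_Max) auto
  show "AE \<omega> in M. norm (Max ((\<lambda>t. X t \<omega>) ` T)) \<le> norm (\<Sum>t\<in>T. \<bar>X t \<omega>\<bar>)"
  proof (rule AE_I2)
    fix \<omega>
    have "Max ((\<lambda>t. X t \<omega>) ` T) \<in> (\<lambda>t. X t \<omega>) ` T"
      using finite_T T_nonempty by (intro Max_in) auto
    then obtain t where t: "t \<in> T" "Max ((\<lambda>t. X t \<omega>) ` T) = X t \<omega>" by blast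
    then have "\<bar>X t \<omega>\<bar> \<le> (\<Sum>t\<in>T. \<bar>X t \<omega>\<bar>)"
      using finite_T by (intro member_le_sum) auto
    with t show "norm (Max ((\<lambda>t. X t \<omega>) ` T)) \<le> norm (\<Sum>t\<in>T. \<bar>X t \<omega>\<bar>)" by simp
  qed
qed

text \<open>The subgradient inequalities at \<open>0\<close> and \<open>\<beta>\<close> place
  \<open>ln Z(\<beta>) - ln |T|\<close> between \<open>\<beta>\<close> times the Gibbs means at
  \<open>0\<close> and at \<open>\<beta>\<close>; both are at most
  \<open>\<bar>\<beta>\<bar>\<close> times the sum of the \<open>\<bar>X t\<bar>\<close> in absolute
  value.\<close>

lemma integrable_log_partition:
  "integrable M (\<lambda>\<omega>. ln (partition_function T (\<lambda>t. X t \<omega>) \<beta>))"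
proof (rule Bochner_Integration.integrable_bound)
  show "integrable M (\<lambda>\<omega>. \<bar>ln (real (card T))\<bar> + \<bar>\<beta>\<bar> * (\<Sum>t\<in>T. \<bar>X t \<omega>\<bar>))"
    using integrable_X
    by (intro Bochner_Integration.integrable_add Bochner_Integration.integrable_mult_right
        Bochner_Integration.integrable_sum integrable_abs) auto
  show "(\<lambda>\<omega>. ln (partition_function T (\<lambda>t. X t \<omega>) \<beta>)) \<in> borel_measurable M"
    unfolding partition_function_def by measurable
  show "AE \<omega> in M. norm (ln (partition_function T (\<lambda>t. X t \<omega>) \<beta>)) \<le>
      norm (\<bar>ln (real (card T))\<bar> + \<bar>\<beta>\<bar> * (\<Sum>t\<in>T. \<bar>X t \<omega>\<bar>))"
  proof (rule AE_I2)
    fix \<omega>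
    let ?x = "\<lambda>t. X t \<omega>" and ?S = "\<Sum>t\<in>T. \<bar>X t \<omega>\<bar>"
    have m: "\<bar>\<beta> * gibbs_mean T ?x s\<bar> \<le> \<bar>\<beta>\<bar> * ?S" for s
      by (simp add: abs_mult mult_left_mono abs_gibbs_mean_le[OF finite_T T_nonempty])
    have "\<bar>ln (partition_function T ?x \<beta>) - ln (real (card T))\<bar> \<le> \<bar>\<beta>\<bar> * ?S"
      using ln_partition_function_subgradient[OF finite_T T_nonempty, of \<beta> 0 ?x] m[of 0]
        ln_partition_function_subgradient[OF finite_T T_nonempty, of 0 \<beta> ?x] m[of \<beta>]
      by (simp add: partition_function_def[of _ _ 0])
    then show "norm (ln (partition_function T ?x \<beta>)) \<le> norm (\<bar>ln (real (card T))\<bar> + \<bar>\<beta>\<bar> * ?S)"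
      by simp
  qed
qed

lemma expectation_KL_div:
  "expectation (\<lambda>\<omega>. KL_div T (gibbs T (\<lambda>t. X t \<omega>) \<beta>) (gibbs T (\<lambda>t. X t \<omega>) 0)) =
    \<beta> * mean_gibbs \<beta> - mean_log_partition \<beta> + ln (real (card T))"
  unfolding KL_div_gibbs[OF finite_T T_nonempty] mean_gibbs_def mean_log_partition_def
  using integrable_gibbs_mean integrable_log_partition
  by (simp add: prob_space)

lemma mean_log_partition_0: "mean_log_partition 0 = ln (real (card T))"
  by (simp add: mean_log_partition_def partition_function_def prob_space)

lemma mean_gibbs_0: "mean_gibbs 0 = 0"
proof -
  have "mean_gibbs 0 = (\<Sum>t\<in>T. expectation (\<lambda>\<omega>. 1 / real (card T) * X t \<omega>))"
    unfolding mean_gibbs_def gibbs_mean_def gibbs_0 using integrable_X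
    by (intro Bochner_Integration.integral_sum) auto
  also have "\<dots> = 0" by (intro sum.neutral) (simp add: expectation_X)
  finally show ?thesis .
qed

lemma mean_log_partition_subgradient:
  "(r - s) * mean_gibbs s \<le> mean_log_partition r - mean_log_partition s"
proof -
  have "expectation (\<lambda>\<omega>. (r - s) * gibbs_mean T (\<lambda>t. X t \<omega>) s) \<le> expectation (\<lambda>\<omega>.
      ln (partition_function T (\<lambda>t. X t \<omega>) r) - ln (partition_function T (\<lambda>t. X t \<omega>) s))"
    using integrable_gibbs_mean integrable_log_partition
    by (intro integral_mono Bochner_Integration.integrable_diff ln_partition_function_subgradient
        Bochner_Integration.integrable_mult_right finite_T T_nonempty) auto
  then show ?thesis
    using integrable_log_partition by (simp add: mean_gibbs_def mean_log_partition_def)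
qed

lemma integrable_sum_gibbs_power2:
  "integrable M (\<lambda>\<omega>. \<Sum>t\<in>T. (gibbs T (\<lambda>s. X s \<omega>) \<beta> t)\<^sup>2)"
  using integrable_gibbs_times[of _ "\<lambda>_. 1"] integrable_gibbs_times
  by (auto simp: power2_eq_square)

text \<open>Sum the integration by parts over \<open>t\<close>; since the weights sum to one, the
  terms \<open>\<nu> t * (1 - \<nu> t)\<close> add up to one minus the sum of squares.\<close>

lemma mean_gibbs_eq:
  "mean_gibbs \<beta> = \<sigma>\<^sup>2 * \<beta> * (1 - expectation (\<lambda>\<omega>. \<Sum>t\<in>T. (gibbs T (\<lambda>s. X s \<omega>) \<beta> t)\<^sup>2))"
proof -
  let ?\<nu> = "\<lambda>\<omega>. gibbs T (\<lambda>s. X s \<omega>) \<beta>"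
  have int: "integrable M (\<lambda>\<omega>. ?\<nu> \<omega> t * (1 - ?\<nu> \<omega> t))" if "t \<in> T" for t
    using integrable_gibbs_times[OF that, of "\<lambda>_. 1"]
      integrable_gibbs_times[OF that, of "\<lambda>\<omega>. 1 - ?\<nu> \<omega> t"]
    by (simp add: mult.commute)
  have "mean_gibbs \<beta> = (\<Sum>t\<in>T. expectation (\<lambda>\<omega>. X t \<omega> * ?\<nu> \<omega> t))"
    unfolding mean_gibbs_def gibbs_mean_def
    using integrable_gibbs_times integrable_X
    by (subst Bochner_Integration.integral_sum[symmetric]) (auto simp: mult.commute)
  also have "\<dots> = \<sigma>\<^sup>2 * \<beta> * (\<Sum>t\<in>T. expectation (\<lambda>\<omega>. ?\<nu> \<omega> t * (1 - ?\<nu> \<omega> t)))"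
    by (simp add: expectation_X_gibbs sum_distrib_left)
  also have "(\<Sum>t\<in>T. expectation (\<lambda>\<omega>. ?\<nu> \<omega> t * (1 - ?\<nu> \<omega> t))) =
      expectation (\<lambda>\<omega>. \<Sum>t\<in>T. ?\<nu> \<omega> t * (1 - ?\<nu> \<omega> t))"
    using int by (intro Bochner_Integration.integral_sum[symmetric])
  also have "(\<lambda>\<omega>. \<Sum>t\<in>T. ?\<nu> \<omega> t * (1 - ?\<nu> \<omega> t)) = (\<lambda>\<omega>. 1 - (\<Sum>t\<in>T. (?\<nu> \<omega> t)\<^sup>2))"
    using sum_gibbs[OF finite_T T_nonempty]
    by (simp add: right_diff_distrib sum_subtractf power2_eq_square)
  also have "expectation \<dots> = 1 - expectation (\<lambda>\<omega>. \<Sum>t\<in>T. (?\<nu> \<omega> t)\<^sup>2)"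
    using integrable_sum_gibbs_power2 by (simp add: prob_space)
  finally show ?thesis .
qed

lemma mean_gibbs_ratio_antimono:
  assumes "0 < s" "s \<le> r"
  shows "mean_gibbs r / r \<le> mean_gibbs s / s"
proof -
  have "expectation (\<lambda>\<omega>. \<Sum>t\<in>T. (gibbs T (\<lambda>s. X s \<omega>) s t)\<^sup>2) \<le>
      expectation (\<lambda>\<omega>. \<Sum>t\<in>T. (gibbs T (\<lambda>s. X s \<omega>) r t)\<^sup>2)"
    using assms finite_T T_nonempty
    by (intro integral_mono integrable_sum_gibbs_power2 sum_gibbs_power2_mono) auto
  then show ?thesis using assms by (simp add: mean_gibbs_eq mult_left_mono)
qed

lemma mean_gibbs_le_mean_max: "mean_gibbs \<beta> \<le> mean_max"
  unfolding mean_gibbs_def mean_max_def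
  using gibbs_mean_le_Max[OF finite_T T_nonempty, of "\<lambda>t. X t _"]
  by (intro integral_mono integrable_gibbs_mean integrable_Max) auto

text \<open>The largest summand of the partition function is already a lower bound for it.\<close>

lemma mean_max_le_mean_log_partition:
  assumes "0 \<le> \<beta>"
  shows "\<beta> * mean_max \<le> mean_log_partition \<beta>"
proof -
  have "expectation (\<lambda>\<omega>. \<beta> * Max ((\<lambda>t. X t \<omega>) ` T)) \<le> mean_log_partition \<beta>"
    unfolding mean_log_partition_def
  proof (intro integral_mono integrable_log_partition Bochner_Integration.integrable_mult_right integrable_Max)
    fix \<omega>
    have "Max ((\<lambda>t. X t \<omega>) ` T) \<in> (\<lambda>t. X t \<omega>) ` T"
      using finite_T T_nonempty by (intro Max_in) auto
    then obtain t where t: "t \<in> T" "Max ((\<lambda>t. X t \<omega>) ` T) = X t \<omega>" by blast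
    have "exp (\<beta> * X t \<omega>) \<le> partition_function T (\<lambda>t. X t \<omega>) \<beta>"
      unfolding partition_function_def using t finite_T
      by (intro member_le_sum[of t T "\<lambda>t. exp (\<beta> * X t \<omega>)"]) auto
    then show "\<beta> * Max ((\<lambda>t. X t \<omega>) ` T) \<le> ln (partition_function T (\<lambda>t. X t \<omega>) \<beta>)"
      using partition_function_pos[OF finite_T T_nonempty] t by (simp add: ln_ge_iff)
  qed
  then show ?thesis by (simp add: mean_max_def)
qed

section \<open>Sudakov minoration for the i.i.d. family\<close>

lemma centered_gaussian_process: "centered_gaussian_process M T X"
  unfolding centered_gaussian_process_def
proof (intro conjI allI impI ballI)
  fix J and a :: "'i \<Rightarrow> real" assume J: "finite J \<and> J \<subseteq> T"
  \<comment> \<open>Terms with coefficient zero are dropped, because the sum rule for normal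
    variables requires positive deviations. If nothing remains, the combination is the constant
    zero, a degenerate Gaussian.\<close>
  define K where "K = {t \<in> J. a t \<noteq> 0}"
  have K: "finite K" "K \<subseteq> T" "\<And>t. t \<in> K \<Longrightarrow> a t \<noteq> 0" using J by (auto simp: K_def)
  have eq: "(\<lambda>\<omega>. \<Sum>t\<in>J. a t * X t \<omega>) = (\<lambda>\<omega>. \<Sum>t\<in>K. a t * X t \<omega>)"
    unfolding K_def using J by (intro ext sum.mono_neutral_right) auto
  show "gaussian_rv M (\<lambda>\<omega>. \<Sum>t\<in>J. a t * X t \<omega>)"
  proof (cases "K = {}")
    case True
    then show ?thesis unfolding eq gaussian_rv_def by auto
  next
    case False
    have "indep_vars (\<lambda>_. borel) (\<lambda>t \<omega>. a t * X t \<omega>) K"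
      using indep_vars_compose2[OF indep_vars_subset[OF indep_X K(2)], of "\<lambda>t x. a t * x"
          "\<lambda>_. borel"] by simp
    moreover have "distributed M lborel (\<lambda>\<omega>. a t * X t \<omega>) (normal_density 0 (\<bar>a t\<bar> * \<sigma>))"
      if "t \<in> K" for t
      using normal_density_affine[OF normal_X \<sigma>_pos K(3)[OF that], of t 0] K that by auto
    ultimately have "distributed M lborel (\<lambda>\<omega>. \<Sum>t\<in>K. a t * X t \<omega>)
        (normal_density (\<Sum>t\<in>K. 0) (sqrt (\<Sum>t\<in>K. (\<bar>a t\<bar> * \<sigma>)\<^sup>2)))"
      using K \<sigma>_pos False by (intro sum_indep_normal) auto
    moreover have "0 < (\<Sum>t\<in>K. (\<bar>a t\<bar> * \<sigma>)\<^sup>2)"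
      using K \<sigma>_pos False by (intro sum_pos) auto
    ultimately show ?thesis
      unfolding eq gaussian_rv_def by (intro disjI1) (metis real_sqrt_gt_zero)
  qed
qed (simp add: expectation_X)

lemma expectation_power2_diff:
  assumes "s \<in> T" "t \<in> T" "s \<noteq> t"
  shows "expectation (\<lambda>\<omega>. \<bar>X s \<omega> - X t \<omega>\<bar>\<^sup>2) = 2 * \<sigma>\<^sup>2"
proof -
  \<comment> \<open>Pairwise independence comes from the restrictions to \<open>{s}\<close> and
    \<open>{t}\<close>, each followed by its only coordinate map.\<close>
  have "indep_var borel (X s) borel (X t)"
    using indep_var_compose[OF indep_var_restrict[OF indep_X, of "{s}" "{t}"],
        of "\<lambda>x. x s" borel "\<lambda>x. x t" borel] assms
    by (simp add: comp_def)
  then have D: "distributed M lborel (\<lambda>\<omega>. X s \<omega> - X t \<omega>)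
      (normal_density (0 - 0) (sqrt (\<sigma>\<^sup>2 + \<sigma>\<^sup>2)))"
    using assms by (intro diff_indep_normal \<sigma>_pos normal_X)
  have "0 < sqrt (\<sigma>\<^sup>2 + \<sigma>\<^sup>2)" using \<sigma>_pos by simp
  from normal_distributed_variance[OF this D] normal_distributed_expectation[OF this D]
  show ?thesis by simp
qed

text \<open>The factor 2 is the square of \<open>sqrt 2\<close> in the separation
  \<open>sqrt 2 * \<sigma>\<close>. The maximum has nonnegative mean because it dominates the
  uniform average, whose mean is zero.\<close>

lemma sudakov_minoration:
  assumes c: "0 < c" "sudakov_constant c"
  shows "2 * (c * \<sigma>)\<^sup>2 * ln (real (card T)) \<le> mean_max\<^sup>2" and "0 \<le> mean_max"
proof -
  have e: "0 \<le> mean_max" using mean_gibbs_le_mean_max[of 0] by (simp add: mean_gibbs_0)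
  have n: "0 < card T" using finite_T T_nonempty by (simp add: card_gt_0_iff)
  then have L: "0 \<le> ln (real (card T))" by simp
  have "2 * (c * \<sigma>)\<^sup>2 * ln (real (card T)) \<le> mean_max\<^sup>2"
  \<comment> \<open>Minoration needs two points; for a single point the logarithm is zero.\<close>
  proof (cases "card T = 1")
    case False
    then have "2 \<le> card T" using n by simp
    then have "sudakov_bound c M T X"
      by (intro sudakov_constantD c prob_space_axioms finite_T centered_gaussian_process)
    moreover have "0 < sqrt 2 * \<sigma>" using \<sigma>_pos by simp
    moreover have "sqrt (expectation (\<lambda>\<omega>. \<bar>X s \<omega> - X t \<omega>\<bar>\<^sup>2)) = sqrt 2 * \<sigma>"
      if "s \<in> T" "t \<in> T" "s \<noteq> t" for s t
      unfolding expectation_power2_diff[OF that] using \<sigma>_pos by (simp add: real_sqrt_mult)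
    ultimately have "c * (sqrt 2 * \<sigma>) * sqrt (ln (real (card T))) \<le> mean_max"
      unfolding sudakov_bound_def mean_max_def by auto
    then have "(c * (sqrt 2 * \<sigma>) * sqrt (ln (real (card T))))\<^sup>2 \<le> mean_max\<^sup>2"
      using c \<sigma>_pos L by (intro power_mono) auto
    then show ?thesis using L by (simp add: power_mult_distrib mult_ac)
  qed simp
  then show "2 * (c * \<sigma>)\<^sup>2 * ln (real (card T)) \<le> mean_max\<^sup>2" "0 \<le> mean_max"
    using e by auto
qed

section \<open>The bound on the mean divergence\<close>

text \<open>The squared form of the goal, with the mean divergence expanded by
  \<open>expectation_KL_div\<close>; the sign of \<open>g\<close> allows square roots to be taken
  afterwards.\<close>

lemma mean_KL_bound:
  assumes c: "0 < c" "sudakov_constant c" and \<beta>: "0 < \<beta>"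
  defines "K \<equiv> (c * \<sigma>)\<^sup>2" and "g \<equiv> mean_gibbs \<beta>"
  shows "0 \<le> g"
    and "K * (\<beta> * g - mean_log_partition \<beta> + ln (real (card T))) \<le> g\<^sup>2"
proof -
  have K: "0 < K" using c \<sigma>_pos by (simp add: K_def)
  define L where "L = ln (real (card T))"
  have L: "2 * K * L \<le> mean_max\<^sup>2" and e: "0 \<le> mean_max"
    using sudakov_minoration[OF c] by (simp_all add: K_def L_def)
  \<comment> \<open>The increment of \<open>F\<close> from \<open>0\<close> to
    \<open>\<beta>\<close> is at least \<open>\<beta> * mean_gibbs 0 = 0\<close> and at most
    \<open>\<beta> * g\<close>.\<close>
  have "0 \<le> \<beta> * g"
    using mean_log_partition_subgradient[of 0 \<beta>] mean_log_partition_subgradient[of \<beta> 0]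
    by (simp add: mean_gibbs_0 g_def)
  then show g: "0 \<le> g" using \<beta> by (simp add: zero_le_mult_iff)
  have bound: "mean_log_partition s - s\<^sup>2 * (g / \<beta>) / 2 \<le> mean_log_partition \<beta> - \<beta> * g / 2"
    if "0 \<le> s" for s
    unfolding g_def
    using subgradient_parabola_bound[of mean_gibbs mean_log_partition, OF
        mean_log_partition_subgradient mean_gibbs_ratio_antimono mean_gibbs_0 \<beta> that] by simp
  have D: "\<beta> * g - mean_log_partition \<beta> + L \<le> \<beta> * g / 2"
    using bound[of 0] by (simp add: mean_log_partition_0 L_def)
  have "K * (\<beta> * g - mean_log_partition \<beta> + L) \<le> g\<^sup>2"
  \<comment> \<open>The value \<open>g = 0\<close> is split off because the comparison point of the
    other case divides by \<open>g\<close>; there \<open>D\<close> alone makes the divergence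
    nonpositive.\<close>
  proof (cases "K * \<beta> \<le> 2 * g \<or> g = 0")
    case True
    then show ?thesis
    proof
      assume "K * \<beta> \<le> 2 * g"
      then have "K * \<beta> * (g / 2) \<le> 2 * g * (g / 2)" using g by (intro mult_right_mono) auto
      moreover have "K * (\<beta> * g - mean_log_partition \<beta> + L) \<le> K * (\<beta> * g / 2)"
        using D K by (intro mult_left_mono) auto
      ultimately show ?thesis by (simp add: power2_eq_square)
    next
      assume "g = 0"
      then show ?thesis using D K by (simp add: mult_le_0_iff)
    qed
  next
    case False
    then have gp: "0 < g" and K\<beta>: "2 * g \<le> K * \<beta>" using g by auto
    define e where "e = mean_max"
    \<comment> \<open>This \<open>s\<close> maximises the lower bound
      \<open>s * e - s^2 * (g / \<beta>) / 2\<close>, with maximal value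
      \<open>\<beta> * e^2 / (2 * g)\<close>.\<close>
    define s where "s = \<beta> * e / g"
    have s: "0 \<le> s" unfolding s_def e_def using e gp \<beta> by simp
    have "s * e - s\<^sup>2 * (g / \<beta>) / 2 \<le> mean_log_partition \<beta> - \<beta> * g / 2"
      using bound[OF s] mean_max_le_mean_log_partition[OF s] by (simp add: e_def)
    moreover have "s * e - s\<^sup>2 * (g / \<beta>) / 2 = \<beta> * e\<^sup>2 / (2 * g)"
      using gp \<beta> by (simp add: s_def field_simps power2_eq_square)
    ultimately have "\<beta> * g - mean_log_partition \<beta> + L \<le>
        L - (\<beta> * e\<^sup>2 / (2 * g) - \<beta> * g / 2)"
      by linarith
    also have "\<beta> * e\<^sup>2 / (2 * g) - \<beta> * g / 2 = \<beta> * ((e\<^sup>2 - g\<^sup>2) / (2 * g))"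
      using gp by (simp add: field_simps power2_eq_square)
    finally have "K * (\<beta> * g - mean_log_partition \<beta> + L) \<le>
        K * (L - \<beta> * ((e\<^sup>2 - g\<^sup>2) / (2 * g)))"
      using K by (intro mult_left_mono) auto
    also have "\<dots> = K * L - K * \<beta> / (2 * g) * (e\<^sup>2 - g\<^sup>2)"
      by (simp add: right_diff_distrib diff_divide_distrib)
    \<comment> \<open>Sudakov bounds the first term, and the case assumption makes the coefficient
      of the nonnegative \<open>e^2 - g^2\<close> at least one. What remains is
      \<open>g^2 - e^2 / 2\<close>.\<close>
    also have "\<dots> \<le> e\<^sup>2 / 2 - 1 * (e\<^sup>2 - g\<^sup>2)"
    proof (intro diff_mono mult_right_mono)
      show "K * L \<le> e\<^sup>2 / 2" using L by (simp add: e_def)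
      show "1 \<le> K * \<beta> / (2 * g)" using K\<beta> gp by (simp add: field_simps)
      show "0 \<le> e\<^sup>2 - g\<^sup>2"
        using mean_gibbs_le_mean_max[of \<beta>] g by (simp add: e_def g_def power_mono)
    qed
    also have "\<dots> \<le> g\<^sup>2" by simp
    finally show ?thesis .
  qed
  then show "K * (\<beta> * g - mean_log_partition \<beta> + ln (real (card T))) \<le> g\<^sup>2" by (simp add: L_def)
qed

end

theorem theorem3:
  fixes M :: "'w measure" and T :: "'i set" and X :: "'i \<Rightarrow> 'w \<Rightarrow> real" and c \<sigma> :: real
  assumes "0 < c" and "c < 1" and "sudakov_constant c"
    and "prob_space M"
    and "finite T" and "T \<noteq> {}"
    and "0 < \<sigma>"
    and "prob_space.indep_vars M (\<lambda>_. borel) X T"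
    and "\<And>t. t \<in> T \<Longrightarrow> distributed M lborel (X t) (normal_density 0 \<sigma>)"
  shows "\<forall>\<beta>\<ge>0. quenched_gibbs_average M T X \<beta> \<ge>
           c * \<sigma> * sqrt (LINT \<omega>|M. KL_div T (gibbs T (\<lambda>t. X t \<omega>) \<beta>) (gibbs T (\<lambda>t. X t \<omega>) 0))"
proof -
  interpret prob_space M by fact
  interpret iid_centered_gaussians M T X \<sigma>
    by unfold_locales (use assms in auto)
  have "c * \<sigma> * sqrt (\<beta> * mean_gibbs \<beta> - mean_log_partition \<beta> + ln (real (card T))) \<le> mean_gibbs \<beta>"
    if "0 \<le> \<beta>" for \<beta>
  \<comment> \<open>At \<open>\<beta> = 0\<close> both sides are zero; \<open>mean_KL_bound\<close>
    covers positive \<open>\<beta>\<close>, where the ratio \<open>g / \<beta>\<close> makes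
    sense.\<close>
  proof (cases "\<beta> = 0")
    case True
    then show ?thesis by (simp add: mean_gibbs_0 mean_log_partition_0)
  next
    case False
    with that have \<beta>: "0 < \<beta>" by simp
    have "sqrt ((c * \<sigma>)\<^sup>2 * (\<beta> * mean_gibbs \<beta> - mean_log_partition \<beta> + ln (real (card T)))) \<le>
        sqrt ((mean_gibbs \<beta>)\<^sup>2)"
      by (intro real_sqrt_le_mono mean_KL_bound[OF \<open>0 < c\<close> \<open>sudakov_constant c\<close> \<beta>])
    then show ?thesis
      using mean_KL_bound(1)[OF \<open>0 < c\<close> \<open>sudakov_constant c\<close> \<beta>] \<open>0 < c\<close> \<open>0 < \<sigma>\<close>
      by (simp add: real_sqrt_mult)
  qed
  then show ?thesis by (simp add: quenched_gibbs_average_eq expectation_KL_div)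
qed

end
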